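(* Let $A\in\mathbb{R}^{m\times n}$, $b\in\mathbb{R}^m$ satisfy the genericity condition $\widetilde\sigma_n>\sigma_{n+1}$, let $x$ be the unique TLS solution, $r=b-Ax$, $P=A^\top A-\sigma_{n+1}^2I_n$, and let $L\in\mathbb{R}^{k\times n}$, $k\le n$. Put $$\mathcal N=P^{-1}\left[-x^\top\otimes\left(A^\top+\frac{2xr^\top}{1+x^\top x}\right)+I_n\otimes r^\top\right],\qquad \mathcal H=P^{-1}\left[A^\top+\frac{2xr^\top}{1+x^\top x}\right].$$ When the infinity norm is chosen on the solution space $\mathbb{R}^k$, the condition number of $\Psi(A,b)=Lx$ is $$\kappa_\infty=\left\|\,|L\mathcal N|\,\mathrm{vec}(|A|)+|L\mathcal H|\,|b|\,\right\|_\infty,$$ and (for $Lx\neq0$) the corresponding relative mixed condition number is $$\kappa_\infty^{\mathrm{rel}}=\frac{\left\|\,|L\mathcal N|\,\mathrm{vec}(|A|)+|L\mathcal H|\,|b|\,\right\|_\infty}{\|Lx\|_\infty}.$$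
   Context: Let $m>n$. The total least squares (TLS) problem for $A\in\mathbb{R}^{m\times n}$, $b\in\mathbb{R}^m$ is to minimize $\|[A,b]-[\widehat A,\widehat b]\|_F$ over $[\widehat A,\widehat b]\in\mathbb{R}^{m\times(n+1)}$ with $\widehat b$ in the range of $\widehat A$; any $x$ with $\widehat A x=\widehat b$ for a minimizer is a TLS solution. Let $\widetilde\sigma_n$ be the smallest singular value of $A$ and $\sigma_{n+1}$ the smallest singular value of $[A,b]$. Under the genericity condition $\widetilde\sigma_n>\sigma_{n+1}$ there is a unique TLS solution $x$; it satisfies $(A^\top A-\sigma_{n+1}^2I_n)x=A^\top b$. $\Psi(A,b)=Lx$ is defined on data satisfying the genericity condition; it is known to be Fréchet differentiable there, with derivative $$\mathsf d\Psi(A,b)\cdot(\mathsf dA,\mathsf db)=LP^{-1}\left[(\mathsf dA)^\top r-\left(A^\top+\tfrac{2xr^\top}{1+x^\top x}\right)\mathsf dA\,x\right]+LP^{-1}\left(A^\top+\tfrac{2xr^\top}{1+x^\top x}\right)\mathsf db .$$ Componentwise norm on the data space: $\|(\mathsf dA,\mathsf db)\|_c=\min\{\omega\ge0: |\mathsf dA|\le\omega|A|,\ |\mathsf db|\le\omega|b|\}$ (entrywise), and $=\infty$ if no such $\omega$ exists. For a norm $\|\cdot\|_{\mathcal V}$ on $\mathbb{R}^k$ the condition number is $\kappa=\max_{\|(\mathsf dA,\mathsf db)\|_c=1}\|\mathsf d\Psi(A,b)\cdot(\mathsf dA,\mathsf db)\|_{\mathcal V}$ and the relative one is $\kappa^{\mathrm{rel}}=\kappa\,\|(A,b)\|_c/\|Lx\|_{\mathcal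 V}=\kappa/\|Lx\|_{\mathcal V}$; the subscript $\infty$ indicates $\|\cdot\|_{\mathcal V}=\|\cdot\|_\infty$. $|\cdot|$ is the entrywise absolute value, $\otimes$ the Kronecker product $[a_{ij}B]$, and $\mathrm{vec}$ stacks columns. *)

theory Defs
  imports "HOL-Analysis.Analysis"
begin

text \<open>
  An \<open>m \<times> n\<close> matrix is a \<^typ>\<open>real^'n^'m\<close> (\<open>m = CARD('m)\<close>, \<open>n = CARD('n)\<close>). On vectors and
  matrices the library's \<open>\<bar>\<cdot>\<bar>\<close> and \<open>\<le>\<close> are entrywise, and the library's \<^const>\<open>norm\<close> of a
  matrix is its Frobenius norm.
\<close>

section \<open>Singular values\<close>

text \<open>
  The square roots of the eigenvalues of \<open>M\<^sup>T M\<close>. These are the singular values of \<open>M\<close> when \<open>M\<close>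
  has at least as many rows as columns, the only case in which the notion is used.
\<close>

definition singular_value :: "real^'n^'m \<Rightarrow> real \<Rightarrow> bool" where
  "singular_value M s \<longleftrightarrow> s \<ge> 0 \<and> (\<exists>v. v \<noteq> 0 \<and> (transpose M ** M) *v v = s\<^sup>2 *\<^sub>R v)"

definition smallest_singular_value :: "real^'n^'m \<Rightarrow> real" where
  "smallest_singular_value M = (LEAST s. singular_value M s)"

section \<open>Total least squares\<close>

text \<open>The block matrix \<open>[A, b]\<close>; the column \<open>b\<close> has the index \<^term>\<open>Inr 1\<close>.\<close>

definition augment :: "real^'n^'m \<Rightarrow> real^'m \<Rightarrow> real^('n + 1)^'m" where
  "augment A b = (\<chi> i j. case j of Inl j' \<Rightarrow> A $ i $ j' | Inr _ \<Rightarrow> b $ i)"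

definition tls_minimizer ::
  "real^'n^'m \<Rightarrow> real^'m \<Rightarrow> real^'n^'m \<Rightarrow> real^'m \<Rightarrow> bool" where
  "tls_minimizer A b A' b' \<longleftrightarrow>
     b' \<in> range ((*v) A') \<and>
     (\<forall>A'' b''. b'' \<in> range ((*v) A'') \<longrightarrow>
        norm (augment A b - augment A' b') \<le> norm (augment A b - augment A'' b''))"

definition tls_solution :: "real^'n^'m \<Rightarrow> real^'m \<Rightarrow> real^'n \<Rightarrow> bool" where
  "tls_solution A b x \<longleftrightarrow> (\<exists>A' b'. tls_minimizer A b A' b' \<and> A' *v x = b')"

definition tls_generic :: "real^'n^'m \<Rightarrow> real^'m \<Rightarrow> bool" where
  "tls_generic A b \<longleftrightarrow> smallest_singular_value A > smallest_singular_value (augment A b)"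

text \<open>
  The solution map \<open>\<Psi>\<close>. It is meaningful only on data with \<^const>\<open>tls_generic\<close>, where the solution
  is unique; the values elsewhere are unspecified.
\<close>

definition tls_map :: "real^'n^'k \<Rightarrow> (real^'n^'m) \<times> (real^'m) \<Rightarrow> real^'k" where
  "tls_map L = (\<lambda>(A, b). L *v (THE x. tls_solution A b x))"

section \<open>Condition numbers\<close>

text \<open>The componentwise norm of \<open>(dA, db)\<close> relative to the data \<open>(A, b)\<close>.\<close>

definition componentwise_norm ::
  "(real^'n^'m) \<times> (real^'m) \<Rightarrow> (real^'n^'m) \<times> (real^'m) \<Rightarrow> ereal" where
  "componentwise_norm = (\<lambda>(A, b) (dA, db).
     if \<exists>\<omega>\<ge>0. \<bar>dA\<bar> \<le> \<omega> *\<^sub>R \<bar>A\<bar> \<and> \<bar>db\<bar> \<le> \<omega> *\<^sub>R \<bar>b\<bar>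
     then ereal (LEAST \<omega>. 0 \<le> \<omega> \<and> \<bar>dA\<bar> \<le> \<omega> *\<^sub>R \<bar>A\<bar> \<and> \<bar>db\<bar> \<le> \<omega> *\<^sub>R \<bar>b\<bar>)
     else \<infinity>)"

text \<open>The argument \<open>N\<close> is the norm chosen on the solution space.\<close>

definition cond_number ::
  "(real^'k \<Rightarrow> real) \<Rightarrow> ((real^'n^'m) \<times> (real^'m) \<Rightarrow> real^'k) \<Rightarrow> (real^'n^'m) \<times> (real^'m) \<Rightarrow> real"
  where
  "cond_number N F p =
     (GREATEST t. \<exists>d. componentwise_norm p d = 1 \<and> t = N (frechet_derivative F (at p) d))"

definition rel_cond_number ::
  "(real^'k \<Rightarrow> real) \<Rightarrow> ((real^'n^'m) \<times> (real^'m) \<Rightarrow> real^'k) \<Rightarrow> (real^'n^'m) \<times> (real^'m) \<Rightarrow> real"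
  where
  "rel_cond_number N F p = cond_number N F p * real_of_ereal (componentwise_norm p p) / N (F p)"

section \<open>Kronecker product and vectorization\<close>

text \<open>
  Block indices are pairs, the first component being the index of the block. Under the lexicographic
  order, the index \<open>(j, i)\<close> in \<open>vec_cols M\<close> is the position of the entry \<open>M\<^sub>i\<^sub>j\<close> when the columns of
  \<open>M\<close> are stacked.
\<close>

definition kron :: "real^'q^'p \<Rightarrow> real^'s^'r \<Rightarrow> real^('q \<times> 's)^('p \<times> 'r)" where
  "kron M N = (\<chi> i j. M $ fst i $ fst j * N $ snd i $ snd j)"

definition vec_cols :: "real^'n^'m \<Rightarrow> real^('n \<times> 'm)" where
  "vec_cols M = (\<chi> p. M $ snd p $ fst p)"

text \<open>
  The rows of \<open>x\<^sup>T \<otimes> B\<close> and of \<open>I \<otimes> r\<^sup>T\<close> are indexed by \<open>1 \<times> 'n\<close> and by \<open>'n \<times> 1\<close>; both are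
  identified with \<open>'n\<close>.
\<close>

definition rows_fst_unit :: "real^'c^(1 \<times> 'n) \<Rightarrow> real^'c^'n" where
  "rows_fst_unit M = (\<chi> i. M $ (1, i))"

definition rows_snd_unit :: "real^'c^('n \<times> 1) \<Rightarrow> real^'c^'n" where
  "rows_snd_unit M = (\<chi> i. M $ (i, 1))"

definition row_matrix :: "real^'n \<Rightarrow> real^'n^1" where
  "row_matrix x = (\<chi> i. x)"

definition outer :: "real^'n \<Rightarrow> real^'m \<Rightarrow> real^'m^'n" where
  "outer x r = (\<chi> i j. x $ i * r $ j)"

end

theory Submission
  imports Defs
begin

text \<open>
  Write \<open>s\<close> for the smallest singular value of \<open>[A, b]\<close>. The formula is the maximum of a linear map
  over a box, once the derivative of \<open>(A, b) \<mapsto> L x\<close> is known; almost all the work is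
  to show that this derivative exists and to compute it.

  \<^emph>\<open>Solutions as minimizers.\<close> The cheapest correction of \<open>[A, b]\<close> that makes \<open>y\<close> an exact solution has
  rank one and squared size \<open>\<parallel>b - A y\<parallel>\<^sup>2 / (1 + \<parallel>y\<parallel>\<^sup>2)\<close>. So the TLS solutions are the minimizers of this
  quotient (\<open>tls_solution_iff\<close>), which is the Rayleigh quotient of \<open>[A, b]\<^sup>T [A, b]\<close> at \<open>(y, -1)\<close>.
  Genericity keeps the minimizing vectors of the full Rayleigh quotient off the hyperplane where the
  last entry vanishes. Hence the minimum is \<open>s\<^sup>2\<close>, and \<open>(x, -1)\<close> is an eigenvector of
  \<open>[A, b]\<^sup>T [A, b]\<close>, that is, \<open>A\<^sup>T (A x - b) = s\<^sup>2 x\<close> and \<open>b \<bullet> (A x - b) = - s\<^sup>2\<close>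
  (\<open>tls_solution_normal_equations\<close>). The matrix \<open>P\<close> is bounded below by the gap between the squared
  singular values, so the solution is unique.

  \<^emph>\<open>Differentiability.\<close> For two generic data, with solutions \<open>x\<close>, \<open>x'\<close>, residuals \<open>r\<close>, \<open>r'\<close>
  and difference \<open>(dA, db)\<close>, the normal equations give, without any remainder,
  \<open>P (x' - x) = dA\<^sup>T r' + A\<^sup>T (db - dA x') + (s'\<^sup>2 - s\<^sup>2) x'\<close> and
  \<open>(s'\<^sup>2 - s\<^sup>2) (1 + x \<bullet> x') = (db - dA x) \<bullet> r' + (db - dA x') \<bullet> r\<close>
  (\<open>tls_solution_difference\<close>, \<open>tls_eigenvalue_difference\<close>). So \<open>x' - x\<close> is a linear map of
  \<open>(dA, db)\<close> whose coefficients depend on \<open>x'\<close> and \<open>r'\<close>. As \<open>x'\<close> is continuous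
  (\<open>tendsto_tls_solution\<close>), letting the coefficients tend to their limits gives the Frechet derivative
  (\<open>has_derivative_tls_solution\<close>).

  \<^emph>\<open>The condition number.\<close> A derivative \<open>M vec(dA) + N db\<close> is bounded, row by row, by
  \<open>\<bar>M\<bar> vec(\<bar>A\<bar>) + \<bar>N\<bar> \<bar>b\<bar>\<close> on the unit ball of the componentwise norm, and choosing the signs of
  \<open>dA\<close> and \<open>db\<close> to match the largest row attains the bound (\<open>cond_number_infnorm\<close>).
\<close>

section \<open>The smallest singular value\<close>

lemma inner_transpose_mult:
  fixes M :: "real^'n^'m"
  shows "(transpose M *v u) \<bullet> v = u \<bullet> (M *v v)"
  by (simp add: dot_lmul_matrix)

lemma norm_matrix_vector_mult_le:
  fixes M :: "real^'n^'m"
  shows "norm (M *v v) \<le> norm M * norm v"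
proof -
  have "norm (M *v v) = L2_set (\<lambda>i. \<bar>M $ i \<bullet> v\<bar>) UNIV"
    by (simp add: norm_vec_def matrix_vector_mul_component)
  also have "\<dots> \<le> L2_set (\<lambda>i. norm (M $ i) * norm v) UNIV"
    by (intro L2_set_mono) (auto simp: Cauchy_Schwarz_ineq2)
  also have "\<dots> = norm M * norm v"
    by (simp add: norm_vec_def [of M] L2_set_left_distrib)
  finally show ?thesis .
qed

lemma bounded_bilinear_matrix_vector_mult:
  "bounded_bilinear ((*v) :: real^'n^'m \<Rightarrow> real^'n \<Rightarrow> real^'m)"
proof (rule bounded_bilinear.intro)
  show "\<exists>K. \<forall>(M :: real^'n^'m) v. norm (M *v v) \<le> norm M * norm v * K"
    by (intro exI [of _ 1]) (simp add: norm_matrix_vector_mult_le)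
qed (auto simp: algebra_simps scaleR_matrix_vector_assoc)

lemma bounded_bilinear_transpose_vector_mult:
  "bounded_bilinear (\<lambda>(M :: real^'n^'m) v. transpose M *v v)"
proof -
  have "bounded_linear (transpose :: real^'n^'m \<Rightarrow> real^'m^'n)"
    unfolding linear_conv_bounded_linear [symmetric]
    by (intro linearI) (auto simp: transpose_def vec_eq_iff)
  from bounded_bilinear.comp1 [OF bounded_bilinear_matrix_vector_mult this]
  show ?thesis .
qed

text \<open>
  The quadratic form \<open>v \<mapsto> \<parallel>M v\<parallel>\<^sup>2 - c \<parallel>v\<parallel>\<^sup>2\<close> is nonnegative and vanishes at \<open>w\<close>. A short step from \<open>w\<close>
  against half of its gradient \<open>z\<close> there would make it negative unless \<open>z = 0\<close>.
\<close>

lemma eigenvector_of_minimal_rayleigh_quotient: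
  fixes M :: "real^'n^'m"
  assumes lower: "\<And>v. c * (norm v)\<^sup>2 \<le> (norm (M *v v))\<^sup>2"
    and attained: "(norm (M *v w))\<^sup>2 \<le> c * (norm w)\<^sup>2"
  shows "transpose M *v (M *v w) = c *\<^sub>R w"
proof -
  define z where "z = transpose M *v (M *v w) - c *\<^sub>R w"
  define Q where "Q = (norm (M *v z))\<^sup>2 - c * (norm z)\<^sup>2"
  have Q: "0 \<le> Q"
    using lower [of z] by (simp add: Q_def)
  have zz: "z \<bullet> z = (M *v w) \<bullet> (M *v z) - c * (w \<bullet> z)"
    by (subst (1) z_def) (simp only: inner_diff_left inner_transpose_mult inner_scaleR_left)
  \<comment> \<open>Along \<open>w - t z\<close> the form is at most \<open>t\<^sup>2 Q - 2 t (z \<bullet> z)\<close>, negative for small \<open>t > 0\<close> if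
    \<open>z \<noteq> 0\<close>; adding 1 to \<open>Q\<close> keeps this step length defined when \<open>Q = 0\<close>.\<close>
  define t where "t = (z \<bullet> z) / (Q + 1)"
  have t: "t * (Q + 1) = z \<bullet> z" "0 \<le> t"
    using Q by (auto simp: t_def)
  have "0 \<le> (norm (M *v (w - t *\<^sub>R z)))\<^sup>2 - c * (norm (w - t *\<^sub>R z))\<^sup>2"
    using lower by simp
  also have "\<dots> = ((norm (M *v w))\<^sup>2 - c * (norm w)\<^sup>2)
      - 2 * t * ((M *v w) \<bullet> (M *v z) - c * (w \<bullet> z)) + t\<^sup>2 * Q"
    unfolding Q_def power2_norm_eq_inner matrix_vector_mult_diff_distrib matrix_vector_mult_scaleR
    by (simp add: inner_diff inner_commute algebra_simps power2_eq_square)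
  also have "\<dots> = ((norm (M *v w))\<^sup>2 - c * (norm w)\<^sup>2) - 2 * t * (z \<bullet> z) + t\<^sup>2 * Q"
    by (simp only: zz)
  also have "\<dots> \<le> - 2 * t * (t * (Q + 1)) + t\<^sup>2 * Q"
    using attained t by simp
  finally have "t\<^sup>2 * (Q + 2) \<le> 0"
    by (simp add: algebra_simps power2_eq_square)
  then have "t = 0"
    using Q by (simp add: mult_le_0_iff)
  with t have "z = 0" by simp
  then show ?thesis by (simp add: z_def)
qed

text \<open>
  The least singular value in the sense of eigenvalues of \<open>M\<^sup>T M\<close> exists and is the minimum of \<open>\<parallel>M v\<parallel>\<close>
  on the unit sphere: that minimum is attained by compactness, at an eigenvector, and any other
  singular value is a value of \<open>\<parallel>M v\<parallel>\<close> at a unit eigenvector.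
\<close>

lemma smallest_singular_value:
  fixes M :: "real^'n^'m"
  shows smallest_singular_value_nonneg: "0 \<le> smallest_singular_value M"
    and smallest_singular_value_le: "smallest_singular_value M * norm v \<le> norm (M *v v)"
    and smallest_singular_value_eigenvector:
      "\<exists>w. w \<noteq> 0 \<and> transpose M *v (M *v w) = (smallest_singular_value M)\<^sup>2 *\<^sub>R w"
proof -
  have "continuous_on (sphere 0 1) (\<lambda>v :: real^'n. norm (M *v v))"
    by (intro continuous_intros linear_continuous_on matrix_vector_mul_bounded_linear)
  moreover have "sphere (0 :: real^'n) 1 \<noteq> {}"
    by (simp add: sphere_eq_empty)
  ultimately obtain u :: "real^'n" where u: "norm u = 1"
    and least: "\<And>v. norm v = 1 \<Longrightarrow> norm (M *v u) \<le> norm (M *v v)"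
    using continuous_attains_inf [OF compact_sphere] by (metis mem_sphere_0)
  define s where "s = norm (M *v u)"
  have lower: "s * norm v \<le> norm (M *v v)" for v
  proof (cases "v = 0")
    case False
    then have "s \<le> norm (M *v (inverse (norm v) *\<^sub>R v))"
      unfolding s_def by (intro least) simp
    with False show ?thesis
      by (simp add: matrix_vector_mult_scaleR field_simps)
  qed simp
  have "s\<^sup>2 * (norm v)\<^sup>2 \<le> (norm (M *v v))\<^sup>2" for v
    unfolding power_mult_distrib [symmetric]
    by (intro power_mono lower) (simp add: s_def)
  then have eigen: "transpose M *v (M *v u) = s\<^sup>2 *\<^sub>R u"
    by (rule eigenvector_of_minimal_rayleigh_quotient) (simp add: s_def u)
  have "u \<noteq> 0" using u by auto
  have "smallest_singular_value M = s"
    unfolding smallest_singular_value_def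
  proof (rule Least_equality)
    show "singular_value M s"
      using eigen \<open>u \<noteq> 0\<close> unfolding singular_value_def
      by (auto simp del: transpose_matrix_vector simp: s_def matrix_vector_mul_assoc intro!: exI [of _ u])
  next
    fix t assume "singular_value M t"
    then obtain v where t: "0 \<le> t" "v \<noteq> 0" "transpose M *v (M *v v) = t\<^sup>2 *\<^sub>R v"
      unfolding singular_value_def matrix_vector_mul_assoc by auto
    have "(norm (M *v v))\<^sup>2 = (transpose M *v (M *v v)) \<bullet> v"
      by (simp only: inner_transpose_mult power2_norm_eq_inner)
    also have "\<dots> = (t * norm v)\<^sup>2"
      unfolding t(3) by (simp add: power_mult_distrib power2_norm_eq_inner)
    finally have "norm (M *v v) = t * norm v"
      using t(1) by (simp add: power2_eq_iff_nonneg)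
    with lower [of v] t(2) show "s \<le> t" by simp
  qed
  with lower eigen \<open>u \<noteq> 0\<close> show "0 \<le> smallest_singular_value M"
    and "smallest_singular_value M * norm v \<le> norm (M *v v)"
    and "\<exists>w. w \<noteq> 0 \<and> transpose M *v (M *v w) = (smallest_singular_value M)\<^sup>2 *\<^sub>R w"
    by (auto simp: s_def)
qed

lemma smallest_singular_value_sq_le:
  fixes M :: "real^'n^'m"
  shows "(smallest_singular_value M)\<^sup>2 * (norm v)\<^sup>2 \<le> (norm (M *v v))\<^sup>2"
  unfolding power_mult_distrib [symmetric]
  by (intro power_mono smallest_singular_value_le) (simp add: smallest_singular_value_nonneg)

lemma smallest_singular_value_attained:
  fixes M :: "real^'n^'m"
  obtains w where "w \<noteq> 0" "norm (M *v w) = smallest_singular_value M * norm w"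
proof -
  obtain w where w: "w \<noteq> 0" "transpose M *v (M *v w) = (smallest_singular_value M)\<^sup>2 *\<^sub>R w"
    using smallest_singular_value_eigenvector by blast
  have "(norm (M *v w))\<^sup>2 = (transpose M *v (M *v w)) \<bullet> w"
    by (simp only: inner_transpose_mult power2_norm_eq_inner)
  also have "\<dots> = (smallest_singular_value M * norm w)\<^sup>2"
    unfolding w(2) by (simp add: power_mult_distrib power2_norm_eq_inner)
  finally have "norm (M *v w) = smallest_singular_value M * norm w"
    by (simp add: power2_eq_iff_nonneg smallest_singular_value_nonneg)
  with w(1) that show ?thesis by blast
qed

text \<open>
  The smallest singular value is a minimum of functions \<open>M \<mapsto> \<parallel>M v\<parallel>\<close> that are 1-Lipschitz for the
  Frobenius norm, hence it is 1-Lipschitz itself. This makes genericity an open condition and \<open>P\<close>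
  continuous in the data.
\<close>

lemma smallest_singular_value_perturbation:
  fixes M N :: "real^'n^'m"
  shows "smallest_singular_value M \<le> smallest_singular_value N + norm (M - N)"
proof -
  obtain w where w: "w \<noteq> 0" "norm (N *v w) = smallest_singular_value N * norm w"
    by (rule smallest_singular_value_attained)
  have "smallest_singular_value M * norm w \<le> norm (M *v w)"
    by (rule smallest_singular_value_le)
  also have "\<dots> = norm (N *v w + (M - N) *v w)"
    by (simp add: matrix_vector_mult_diff_rdistrib)
  also have "\<dots> \<le> norm (N *v w) + norm (M - N) * norm w"
    by (intro order_trans [OF norm_triangle_ineq] add_mono order_refl norm_matrix_vector_mult_le)
  also have "\<dots> = (smallest_singular_value N + norm (M - N)) * norm w"
    by (simp add: w(2) algebra_simps)
  finally show ?thesis using w(1) by simp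
qed

lemma tendsto_smallest_singular_value [tendsto_intros]:
  fixes M :: "'a \<Rightarrow> real^'n^'m"
  assumes "(M \<longlongrightarrow> N) F"
  shows "((\<lambda>q. smallest_singular_value (M q)) \<longlongrightarrow> smallest_singular_value N) F"
proof -
  have "norm (smallest_singular_value (M q) - smallest_singular_value N) \<le> norm (M q - N)" for q
    using smallest_singular_value_perturbation [of "M q" N]
      smallest_singular_value_perturbation [of N "M q"]
    by (simp add: norm_minus_commute)
  then have "((\<lambda>q. smallest_singular_value (M q) - smallest_singular_value N) \<longlongrightarrow> 0) F"
    by (intro Lim_null_comparison [OF always_eventually tendsto_norm_zero [OF LIM_zero [OF assms]]])
      blast
  then show ?thesis by (rule LIM_zero_cancel)
qed

section \<open>The augmented matrix\<close>

definition append_entry :: "real^'n \<Rightarrow> real \<Rightarrow> real^('n + 1)" where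
  "append_entry v t = (\<chi> j. case j of Inl i \<Rightarrow> v $ i | Inr _ \<Rightarrow> t)"

lemma sum_UNIV_Plus:
  "(\<Sum>j\<in>UNIV. f j) = (\<Sum>i\<in>UNIV. f (Inl i)) + (\<Sum>i\<in>UNIV. f (Inr i))"
  for f :: "'a :: finite + 'b :: finite \<Rightarrow> 'c :: comm_monoid_add"
  by (subst UNIV_Plus_UNIV [symmetric], subst sum.Plus) simp_all

lemma append_entry_cases:
  obtains v t where "w = append_entry v t"
proof
  show "w = append_entry (\<chi> i. w $ Inl i) (w $ Inr 1)"
    by (auto simp: append_entry_def vec_eq_iff split: sum.split)
qed

lemma append_entry_eq_iff [simp]:
  "append_entry v t = append_entry v' t' \<longleftrightarrow> v = v' \<and> t = t'"
  by (auto simp: append_entry_def vec_eq_iff split: sum.splits)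

lemma append_entry_0 [simp]: "append_entry 0 0 = 0"
  by (auto simp: append_entry_def vec_eq_iff split: sum.splits)

lemma scaleR_append_entry: "c *\<^sub>R append_entry v t = append_entry (c *\<^sub>R v) (c * t)"
  by (auto simp: append_entry_def vec_eq_iff split: sum.splits)

lemma norm_append_entry_sq: "(norm (append_entry v t))\<^sup>2 = (norm v)\<^sup>2 + t\<^sup>2"
  unfolding power2_norm_eq_inner
  by (simp add: inner_vec_def sum_UNIV_Plus append_entry_def power2_eq_square)

lemma norm_append_minus_one_sq: "(norm (append_entry v (- 1)))\<^sup>2 = 1 + v \<bullet> v"
  by (simp add: norm_append_entry_sq dot_square_norm)

lemma augment_mult_append_entry: "augment A b *v append_entry v t = A *v v + t *\<^sub>R b"
  by (simp add: vec_eq_iff matrix_vector_mult_def sum_UNIV_Plus append_entry_def augment_def)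

lemma transpose_augment_mult:
  "transpose (augment A b) *v u = append_entry (transpose A *v u) (b \<bullet> u)"
  unfolding vec_eq_iff
  by (auto simp: matrix_vector_mult_def transpose_def augment_def append_entry_def inner_vec_def
      simp del: transpose_matrix_vector split: sum.splits)

lemma tendsto_augment [tendsto_intros]:
  assumes "(M \<longlongrightarrow> A) F" "(c \<longlongrightarrow> b) F"
  shows "((\<lambda>q. augment (M q) (c q)) \<longlongrightarrow> augment A b) F"
  unfolding augment_def
proof (intro tendsto_vec_lambda)
  show "((\<lambda>q. case j of Inl j' \<Rightarrow> M q $ i $ j' | Inr _ \<Rightarrow> c q $ i)
      \<longlongrightarrow> (case j of Inl j' \<Rightarrow> A $ i $ j' | Inr _ \<Rightarrow> b $ i)) F" for i j
    by (cases j) (auto intro!: tendsto_vec_nth assms)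
qed

lemma norm_outer: "norm (outer u v) = norm u * norm v"
proof -
  have "norm (outer u v) = L2_set (\<lambda>i. norm (u $ i *\<^sub>R v)) UNIV"
    unfolding outer_def norm_vec_def [of "\<chi> i j. u $ i * v $ j"]
    by (intro L2_set_cong arg_cong [of _ _ norm]) (simp_all add: vec_eq_iff)
  then show ?thesis
    by (simp add: norm_vec_def [of u] L2_set_left_distrib)
qed

lemma outer_mult: "outer u v *v y = (v \<bullet> y) *\<^sub>R u"
  by (simp add: outer_def vec_eq_iff matrix_vector_mult_def inner_vec_def sum_distrib_left
      sum_distrib_right mult_ac)

lemma augment_minus: "augment A b - augment A' b' = augment (A - A') (b - b')"
  by (auto simp: augment_def vec_eq_iff split: sum.split)

lemma augment_outer: "augment (outer u v) (t *\<^sub>R u) = outer u (append_entry v t)"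
  by (auto simp: augment_def outer_def append_entry_def vec_eq_iff split: sum.split)

section \<open>Solutions of the total least squares problem\<close>

text \<open>
  With \<open>w = (y, -1)\<close>, the compatible matrix \<open>[A', b']\<close> annihilates \<open>w\<close>, so the correction
  \<open>[A, b] - [A', b']\<close> maps \<open>w\<close> to \<open>A y - b\<close> and cannot be smaller than \<open>\<parallel>A y - b\<parallel> / \<parallel>w\<parallel>\<close>.
\<close>

lemma tls_distance_lower:
  assumes "A' *v y = b'"
  shows "(norm (b - A *v y))\<^sup>2 \<le> (norm (augment A b - augment A' b'))\<^sup>2 * (1 + y \<bullet> y)"
proof -
  let ?w = "append_entry y (- 1)"
  have "(augment A b - augment A' b') *v ?w = - (b - A *v y)"
    by (simp add: assms augment_minus augment_mult_append_entry matrix_vector_mult_diff_rdistrib)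
  then have "norm (b - A *v y) \<le> norm (augment A b - augment A' b') * norm ?w"
    by (metis norm_matrix_vector_mult_le norm_minus_cancel)
  then have "(norm (b - A *v y))\<^sup>2 \<le> (norm (augment A b - augment A' b') * norm ?w)\<^sup>2"
    by (intro power_mono) auto
  then show ?thesis
    by (simp add: power_mult_distrib norm_append_minus_one_sq)
qed

text \<open>
  The minimal correction is the rank one matrix \<open>(A y - b) w\<^sup>T / \<parallel>w\<parallel>\<^sup>2\<close> with \<open>w = (y, -1)\<close>.
\<close>

lemma tls_distance_attained:
  fixes A :: "real^'n^'m" and y :: "real^'n"
  obtains A' b' where "A' *v y = b'"
    and "(norm (augment A b - augment A' b'))\<^sup>2 * (1 + y \<bullet> y) = (norm (b - A *v y))\<^sup>2"
proof -
  define e where "e = (1 / (1 + y \<bullet> y)) *\<^sub>R (A *v y - b)"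
  have pos: "0 < 1 + y \<bullet> y"
    by (simp add: add_pos_nonneg)
  have e: "(1 + y \<bullet> y) *\<^sub>R e = A *v y - b"
    using pos by (simp add: e_def)
  have "(A - outer e y) *v y = b + e"
    using e by (simp add: matrix_vector_mult_diff_rdistrib outer_mult algebra_simps)
  moreover have "augment A b - augment (A - outer e y) (b + e) = outer e (append_entry y (- 1))"
    using augment_outer [of e y "- 1"] by (simp add: augment_minus)
  then have "(norm (augment A b - augment (A - outer e y) (b + e)))\<^sup>2 * (1 + y \<bullet> y)
      = (norm ((1 + y \<bullet> y) *\<^sub>R e))\<^sup>2"
    by (simp only: norm_outer power_mult_distrib norm_append_minus_one_sq norm_scaleR power2_abs)
      (simp add: power2_eq_square)
  then have "(norm (augment A b - augment (A - outer e y) (b + e)))\<^sup>2 * (1 + y \<bullet> y)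
      = (norm (b - A *v y))\<^sup>2"
    unfolding e by (simp add: norm_minus_commute)
  ultimately show ?thesis by (rule that)
qed

text \<open>
  The minimization over matrices splits: first over the compatible matrices with a prescribed solution
  \<open>y\<close>, which the two preceding lemmas carry out, then over \<open>y\<close>.
\<close>

lemma tls_solution_iff:
  fixes A :: "real^'n^'m"
  shows "tls_solution A b x \<longleftrightarrow>
    (\<forall>y. (norm (b - A *v x))\<^sup>2 / (1 + x \<bullet> x) \<le> (norm (b - A *v y))\<^sup>2 / (1 + y \<bullet> y))"
proof
  have pos: "0 < 1 + y \<bullet> y" for y :: "real^'n"
    by (simp add: add_pos_nonneg)
  {
    assume "tls_solution A b x"
    then obtain A' b' where min: "tls_minimizer A b A' b'" and x: "A' *v x = b'"
      unfolding tls_solution_def by blast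
    show "\<forall>y. (norm (b - A *v x))\<^sup>2 / (1 + x \<bullet> x) \<le> (norm (b - A *v y))\<^sup>2 / (1 + y \<bullet> y)"
    proof
      fix y
      obtain A'' b'' where y: "A'' *v y = b''"
        "(norm (augment A b - augment A'' b''))\<^sup>2 * (1 + y \<bullet> y) = (norm (b - A *v y))\<^sup>2"
        by (rule tls_distance_attained)
      have "(norm (b - A *v x))\<^sup>2 / (1 + x \<bullet> x) \<le> (norm (augment A b - augment A' b'))\<^sup>2"
        using tls_distance_lower [OF x] pos by (simp add: pos_divide_le_eq)
      also have "\<dots> \<le> (norm (augment A b - augment A'' b''))\<^sup>2"
        using min y(1) unfolding tls_minimizer_def by (intro power_mono) auto
      also have "\<dots> = (norm (b - A *v y))\<^sup>2 / (1 + y \<bullet> y)"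
        using y(2) pos [of y] by (simp add: field_simps)
      finally show "(norm (b - A *v x))\<^sup>2 / (1 + x \<bullet> x) \<le> (norm (b - A *v y))\<^sup>2 / (1 + y \<bullet> y)" .
    qed
  next
    assume min: "\<forall>y. (norm (b - A *v x))\<^sup>2 / (1 + x \<bullet> x) \<le> (norm (b - A *v y))\<^sup>2 / (1 + y \<bullet> y)"
    obtain A' b' where x: "A' *v x = b'"
      "(norm (augment A b - augment A' b'))\<^sup>2 * (1 + x \<bullet> x) = (norm (b - A *v x))\<^sup>2"
      by (rule tls_distance_attained)
    have "tls_minimizer A b A' b'"
      unfolding tls_minimizer_def
    proof (intro conjI allI impI)
      show "b' \<in> range ((*v) A')"
        using x(1) by blast
      fix A'' :: "real^'n^'m" and b''
      assume "b'' \<in> range ((*v) A'')"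
      then obtain y where y: "A'' *v y = b''" by blast
      have "(norm (augment A b - augment A' b'))\<^sup>2 = (norm (b - A *v x))\<^sup>2 / (1 + x \<bullet> x)"
        using x(2) pos [of x] by (simp add: field_simps)
      also have "\<dots> \<le> (norm (b - A *v y))\<^sup>2 / (1 + y \<bullet> y)"
        using min by blast
      also have "\<dots> \<le> (norm (augment A b - augment A'' b''))\<^sup>2"
        using tls_distance_lower [OF y] pos by (simp add: pos_divide_le_eq)
      finally show "norm (augment A b - augment A' b') \<le> norm (augment A b - augment A'' b'')"
        by (simp add: power2_le_iff_abs_le)
    qed
    then show "tls_solution A b x"
      using x(1) unfolding tls_solution_def by blast
  }
qed

lemma norm_augment_append_entry:
  "norm (augment A b *v append_entry y (- 1)) = norm (b - A *v y)"
  by (simp add: augment_mult_append_entry norm_minus_commute)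

lemma tls_generic_nonzero: "tls_generic A b \<Longrightarrow> A \<noteq> 0"
proof
  assume gen: "tls_generic A b" and "A = 0"
  obtain w where w: "w \<noteq> 0" "norm (A *v w) = smallest_singular_value A * norm w"
    by (rule smallest_singular_value_attained)
  with gen \<open>A = 0\<close> show False
    using smallest_singular_value_nonneg [of "augment A b"] by (auto simp: tls_generic_def)
qed

lemma tls_objective_lower:
  "(smallest_singular_value (augment A b))\<^sup>2 \<le> (norm (b - A *v y))\<^sup>2 / (1 + y \<bullet> y)"
  using smallest_singular_value_sq_le [of "augment A b" "append_entry y (- 1)"]
  by (simp add: norm_augment_append_entry norm_append_minus_one_sq
      add_pos_nonneg pos_le_divide_eq)

text \<open>
  This is where genericity enters. A minimal right singular vector of \<open>[A, b]\<close> with last entry 0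
  would be a vector on which \<open>A\<close> alone is as small as \<open>[A, b]\<close>, which the gap excludes. The vector
  can therefore be scaled to the form \<open>(y, -1)\<close>.
\<close>

lemma tls_objective_attained:
  fixes A :: "real^'n^'m"
  assumes "tls_generic A b"
  obtains y where "(norm (b - A *v y))\<^sup>2 / (1 + y \<bullet> y) = (smallest_singular_value (augment A b))\<^sup>2"
proof -
  let ?s = "smallest_singular_value (augment A b)"
  obtain w where w: "w \<noteq> 0" "norm (augment A b *v w) = ?s * norm w"
    by (rule smallest_singular_value_attained)
  obtain v t where vt: "w = append_entry v t"
    by (rule append_entry_cases)
  have "t \<noteq> 0"
  proof
    assume t: "t = 0"
    with w(1) have "v \<noteq> 0"
      by (auto simp: vt)
    have "(norm w)\<^sup>2 = (norm v)\<^sup>2"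
      by (simp add: vt t norm_append_entry_sq)
    then have "norm w = norm v"
      by (simp add: power2_eq_iff_nonneg)
    then have "norm (A *v v) = ?s * norm v"
      using w(2) by (simp add: vt t augment_mult_append_entry)
    moreover have "?s * norm v < smallest_singular_value A * norm v"
      using assms \<open>v \<noteq> 0\<close> by (simp add: tls_generic_def)
    ultimately show False
      using smallest_singular_value_le [of A v] by simp
  qed
  define y where "y = (- 1 / t) *\<^sub>R v"
  have y: "append_entry y (- 1) = (- 1 / t) *\<^sub>R w"
    using \<open>t \<noteq> 0\<close> by (simp add: vt y_def scaleR_append_entry)
  have "norm (augment A b *v append_entry y (- 1)) = ?s * norm (append_entry y (- 1))"
    unfolding y matrix_vector_mult_scaleR norm_scaleR w(2) by simp
  then have "(norm (b - A *v y))\<^sup>2 = ?s\<^sup>2 * (1 + y \<bullet> y)"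
    unfolding norm_augment_append_entry
    by (simp add: power_mult_distrib norm_append_minus_one_sq)
  then have "(norm (b - A *v y))\<^sup>2 / (1 + y \<bullet> y) = ?s\<^sup>2"
    by (simp add: add_pos_nonneg less_imp_neq [symmetric] nonzero_divide_eq_eq)
  then show ?thesis by (rule that)
qed

text \<open>
  Both equations are the two blocks of \<open>[A, b]\<^sup>T [A, b] w = s\<^sup>2 w\<close> for the minimizing vector
  \<open>w = (x, -1)\<close>.
\<close>

lemma tls_solution_normal_equations:
  fixes A :: "real^'n^'m"
  assumes "tls_generic A b" and "tls_solution A b x"
  shows "transpose A *v (A *v x - b) = (smallest_singular_value (augment A b))\<^sup>2 *\<^sub>R x"
    and "b \<bullet> (A *v x - b) = - (smallest_singular_value (augment A b))\<^sup>2"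
proof -
  let ?C = "augment A b" and ?w = "append_entry x (- 1)"
  let ?s = "smallest_singular_value ?C"
  obtain y where "(norm (b - A *v y))\<^sup>2 / (1 + y \<bullet> y) = ?s\<^sup>2"
    by (rule tls_objective_attained [OF assms(1)])
  with assms(2) have "(norm (b - A *v x))\<^sup>2 / (1 + x \<bullet> x) \<le> ?s\<^sup>2"
    unfolding tls_solution_iff by metis
  then have "(norm (?C *v ?w))\<^sup>2 \<le> ?s\<^sup>2 * (norm ?w)\<^sup>2"
    by (simp add: norm_augment_append_entry norm_append_minus_one_sq
        add_pos_nonneg pos_divide_le_eq)
  with smallest_singular_value_sq_le [of ?C]
  have "transpose ?C *v (?C *v ?w) = ?s\<^sup>2 *\<^sub>R ?w"
    by (rule eigenvector_of_minimal_rayleigh_quotient)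
  then show "transpose A *v (A *v x - b) = ?s\<^sup>2 *\<^sub>R x" and "b \<bullet> (A *v x - b) = - ?s\<^sup>2"
    unfolding transpose_augment_mult scaleR_append_entry
    by (simp_all add: augment_mult_append_entry del: transpose_matrix_vector)
qed

definition tls_matrix :: "real^'n^'m \<Rightarrow> real^'m \<Rightarrow> real^'n^'n" where
  "tls_matrix A b = transpose A ** A - (smallest_singular_value (augment A b))\<^sup>2 *\<^sub>R mat 1"

lemma tls_matrix_mult:
  "tls_matrix A b *v v
     = transpose A *v (A *v v) - (smallest_singular_value (augment A b))\<^sup>2 *\<^sub>R v"
  unfolding tls_matrix_def matrix_vector_mult_diff_rdistrib
  by (simp add: matrix_vector_mul_assoc scaleR_matrix_vector_assoc [symmetric]
      del: transpose_matrix_vector)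

definition tls_gap :: "real^'n^'m \<Rightarrow> real^'m \<Rightarrow> real" where
  "tls_gap A b = (smallest_singular_value A)\<^sup>2 - (smallest_singular_value (augment A b))\<^sup>2"

lemma tls_gap_pos: "tls_generic A b \<Longrightarrow> 0 < tls_gap A b"
  unfolding tls_generic_def tls_gap_def
  by (simp add: power_strict_mono smallest_singular_value_nonneg)

text \<open>
  The constant depends continuously on the data and is positive on generic data, so the bound is
  uniform near a generic point. It serves both for the invertibility of \<open>P\<close> and for the continuity
  of the solution.
\<close>

lemma tls_matrix_coercive:
  fixes A :: "real^'n^'m"
  shows "tls_gap A b * norm v \<le> norm (tls_matrix A b *v v)"
proof (cases "v = 0")
  case False
  have "tls_gap A b * (norm v)\<^sup>2
      \<le> (norm (A *v v))\<^sup>2 - (smallest_singular_value (augment A b))\<^sup>2 * (norm v)\<^sup>2"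
    using smallest_singular_value_sq_le [of A v] by (simp add: tls_gap_def algebra_simps)
  also have "\<dots> = (tls_matrix A b *v v) \<bullet> v"
    unfolding tls_matrix_mult
    by (simp only: inner_diff_left inner_transpose_mult power2_norm_eq_inner inner_scaleR_left)
  also have "\<dots> \<le> norm (tls_matrix A b *v v) * norm v"
    by (rule norm_cauchy_schwarz)
  finally show ?thesis
    using False by (simp add: power2_eq_square mult.assoc [symmetric])
qed simp

lemma tls_solution_linear_system:
  assumes "tls_generic A b" and "tls_solution A b x"
  shows "tls_matrix A b *v x = transpose A *v b"
  using tls_solution_normal_equations(1) [OF assms]
  unfolding tls_matrix_mult matrix_vector_mult_diff_distrib
  by (simp add: algebra_simps del: transpose_matrix_vector)

lemma tls_matrix_inverse:
  assumes "tls_generic A b"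
  shows "matrix_inv (tls_matrix A b) *v (tls_matrix A b *v v) = v"
proof -
  have "v = 0" if "tls_matrix A b *v v = 0" for v
    using tls_matrix_coercive [of A b v] tls_gap_pos [OF assms] that
    by (simp add: mult_le_0_iff)
  then have "invertible (tls_matrix A b)"
    by (simp add: invertible_left_inverse matrix_left_invertible_ker)
  then have "matrix_inv (tls_matrix A b) ** tls_matrix A b = mat 1"
    unfolding invertible_def matrix_inv_def by (rule someI2_ex) simp
  then show ?thesis
    by (simp add: matrix_vector_mul_assoc)
qed

lemma tls_solution_unique:
  assumes "tls_generic A b" "tls_solution A b x" "tls_solution A b y"
  shows "x = y"
  using tls_matrix_inverse [OF assms(1)] tls_solution_linear_system [OF assms(1)] assms(2,3)
  by metis

lemma tls_solution_exists:
  assumes "tls_generic A b"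
  shows "\<exists>x. tls_solution A b x"
proof -
  obtain y where "(norm (b - A *v y))\<^sup>2 / (1 + y \<bullet> y) = (smallest_singular_value (augment A b))\<^sup>2"
    by (rule tls_objective_attained [OF assms])
  then have "tls_solution A b y"
    by (simp add: tls_solution_iff tls_objective_lower)
  then show ?thesis by blast
qed

lemma tls_solution_The:
  assumes "tls_generic A b"
  shows "tls_solution A b (THE x. tls_solution A b x)"
  using tls_solution_exists [OF assms] tls_solution_unique [OF assms] by (blast intro: theI)

section \<open>Perturbation of the solution\<close>

text \<open>
  Let \<open>C = [A, b]\<close>, \<open>C' = [A', b']\<close>, \<open>w = (x, -1)\<close> and \<open>w' = (x', -1)\<close>. The eigenvalue equations
  give \<open>(C w) \<bullet> (C w') = s\<^sup>2 (w \<bullet> w')\<close> and \<open>(C' w) \<bullet> (C' w') = s'\<^sup>2 (w \<bullet> w')\<close>. Subtracting them leaves an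
  expression that is linear in \<open>C' - C\<close> apart from coefficients that depend on the new solution.
\<close>

lemma tls_eigenvalue_difference:
  fixes A A' :: "real^'n^'m"
  assumes "tls_generic A b" "tls_solution A b x" "tls_generic A' b'" "tls_solution A' b' x'"
  shows "((smallest_singular_value (augment A' b'))\<^sup>2 - (smallest_singular_value (augment A b))\<^sup>2)
        * (1 + x \<bullet> x')
      = ((b' - b) - (A' - A) *v x) \<bullet> (b' - A' *v x') + ((b' - b) - (A' - A) *v x') \<bullet> (b - A *v x)"
proof -
  have product: "(A *v y - b) \<bullet> (A *v x - b) = (smallest_singular_value (augment A b))\<^sup>2 * (1 + x \<bullet> y)"
    if "tls_generic A b" "tls_solution A b x" for A :: "real^'n^'m" and b x y
  proof -
    have "(A *v y - b) \<bullet> (A *v x - b) = (A *v x - b) \<bullet> (A *v y) - b \<bullet> (A *v x - b)"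
      by (simp only: inner_diff_left inner_commute [of _ "A *v y"])
    also have "\<dots> = (transpose A *v (A *v x - b)) \<bullet> y - b \<bullet> (A *v x - b)"
      by (simp only: inner_transpose_mult)
    finally have "(A *v y - b) \<bullet> (A *v x - b)
        = (transpose A *v (A *v x - b)) \<bullet> y - b \<bullet> (A *v x - b)" .
    then show ?thesis
      unfolding tls_solution_normal_equations [OF that] by (simp add: algebra_simps)
  qed
  show ?thesis
    using product [OF assms(1,2), of x'] product [OF assms(3,4), of x]
    by (simp add: matrix_vector_mult_diff_rdistrib inner_diff inner_commute algebra_simps)
qed

lemma tls_solution_difference:
  fixes A A' :: "real^'n^'m"
  assumes "tls_generic A b" "tls_solution A b x" "tls_generic A' b'" "tls_solution A' b' x'"
  shows "tls_matrix A b *v (x' - x)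
      = transpose (A' - A) *v (b' - A' *v x')
        + transpose A *v ((b' - b) - (A' - A) *v x')
        + ((smallest_singular_value (augment A' b'))\<^sup>2 - (smallest_singular_value (augment A b))\<^sup>2) *\<^sub>R x'"
proof -
  have "transpose (A' - A) *v u = transpose A' *v u - transpose A *v u" for u
    by (simp add: vector_matrix_mult_diff_rdistrib)
  moreover have "transpose A *v (A *v x)
      = (smallest_singular_value (augment A b))\<^sup>2 *\<^sub>R x + transpose A *v b"
    and "transpose A' *v (A' *v x')
      = (smallest_singular_value (augment A' b'))\<^sup>2 *\<^sub>R x' + transpose A' *v b'"
    using tls_solution_normal_equations(1) [OF assms(1,2)]
      tls_solution_normal_equations(1) [OF assms(3,4)]
    by (simp_all only: matrix_vector_mult_diff_distrib diff_eq_eq)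
  ultimately show ?thesis
    by (simp only: tls_matrix_mult matrix_vector_mult_diff_distrib matrix_vector_mult_diff_rdistrib)
      (simp add: scaleR_diff_left scaleR_diff_right del: transpose_matrix_vector)
qed

text \<open>
  A product rule that asks for mere continuity of the second factor, because the first factor vanishes
  at the point: the term in which the second factor would be differentiated is multiplied by 0. It
  turns an exact difference formula with continuous coefficients into a derivative.
\<close>

lemma has_derivative_bilinear_vanishing:
  fixes prod :: "'a::real_normed_vector \<Rightarrow> 'b::real_normed_vector \<Rightarrow> 'c::real_normed_vector"
    and s :: "'d::real_normed_vector \<Rightarrow> 'a"
  assumes "bounded_bilinear prod"
    and s: "(s has_derivative s') (at p)" and "s p = 0"
    and c: "(c \<longlongrightarrow> c0) (at p)"
  shows "((\<lambda>q. prod (s q) (c q)) has_derivative (\<lambda>h. prod (s' h) c0)) (at p)"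
proof -
  interpret bounded_bilinear prod by fact
  obtain B where B: "0 < B" "\<And>u v. norm (prod u v) \<le> norm u * norm v * B"
    using pos_bounded by blast
  from s have lin: "bounded_linear s'"
    and rem: "((\<lambda>q. (1 / norm (q - p)) *\<^sub>R (s q - (s p + s' (q - p)))) \<longlongrightarrow> 0) (at p)"
    by (auto simp: has_derivative_at2)
  obtain K where K: "\<And>h. norm (s' h) \<le> norm h * K"
    using bounded_linear.bounded [OF lin] by blast
  define e where "e q = norm ((1 / norm (q - p)) *\<^sub>R (s q - (s p + s' (q - p))))" for q
  have e_lim: "(e \<longlongrightarrow> 0) (at p)"
    unfolding e_def using rem by (rule tendsto_norm_zero)
  have bound: "norm (s q) \<le> (e q + K) * norm (q - p)" if "q \<noteq> p" for q
  proof -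
    have "norm (s q) \<le> norm (s q - s' (q - p)) + norm (s' (q - p))"
      using norm_triangle_ineq [of "s q - s' (q - p)" "s' (q - p)"] by simp
    also have "norm (s q - s' (q - p)) = e q * norm (q - p)"
      using that \<open>s p = 0\<close> by (simp add: e_def)
    also note K [of "q - p"]
    finally show ?thesis by (simp add: algebra_simps)
  qed
  have "((\<lambda>q. prod (s q) (c q - c0)) has_derivative (\<lambda>h. 0)) (at p)"
    unfolding has_derivative_at2
  proof (intro conjI bounded_linear_zero)
    have lim: "((\<lambda>q. (e q + K) * norm (c q - c0) * B) \<longlongrightarrow> (0 + K) * 0 * B) (at p)"
      by (intro tendsto_intros e_lim tendsto_norm_zero [OF LIM_zero [OF c]])
    have le: "norm ((1 / norm (q - p)) *\<^sub>R
          (prod (s q) (c q - c0) - (prod (s p) (c p - c0) + 0))) \<le> (e q + K) * norm (c q - c0) * B"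
      if "q \<noteq> p" for q
    proof -
      have "norm (prod (s q) (c q - c0)) \<le> norm (s q) * norm (c q - c0) * B"
        by (rule B)
      also have "\<dots> \<le> ((e q + K) * norm (q - p)) * norm (c q - c0) * B"
        using B(1) by (intro mult_right_mono bound that) auto
      also have "\<dots> = ((e q + K) * norm (c q - c0) * B) * norm (q - p)"
        by (simp only: mult_ac)
      finally have "norm (prod (s q) (c q - c0)) / norm (q - p) \<le> (e q + K) * norm (c q - c0) * B"
        using that by (simp add: pos_divide_le_eq)
      then show ?thesis
        by (simp add: \<open>s p = 0\<close> zero_left)
    qed
    show "((\<lambda>q. (1 / norm (q - p)) *\<^sub>R
        (prod (s q) (c q - c0) - (prod (s p) (c p - c0) + 0))) \<longlongrightarrow> 0) (at p)"
    proof (rule Lim_null_comparison)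
      show "\<forall>\<^sub>F q in at p. norm ((1 / norm (q - p)) *\<^sub>R
          (prod (s q) (c q - c0) - (prod (s p) (c p - c0) + 0))) \<le> (e q + K) * norm (c q - c0) * B"
        using eventually_neq_at_within by (rule eventually_mono) (rule le)
      show "((\<lambda>q. (e q + K) * norm (c q - c0) * B) \<longlongrightarrow> 0) (at p)"
        using lim by simp
    qed
  qed
  moreover have "((\<lambda>q. prod (s q) c0) has_derivative (\<lambda>h. prod (s' h) c0)) (at p)"
    by (rule bounded_linear.has_derivative [OF bounded_linear_left s])
  ultimately have "((\<lambda>q. prod (s q) c0 + prod (s q) (c q - c0)) has_derivative
      (\<lambda>h. prod (s' h) c0 + 0)) (at p)"
    by (intro has_derivative_add)
  then show ?thesis
    by (simp add: diff_right)
qed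

lemma eventually_tls_generic:
  assumes "tls_generic A b" "(M \<longlongrightarrow> A) F" "(c \<longlongrightarrow> b) F"
  shows "\<forall>\<^sub>F q in F. tls_generic (M q) (c q)"
proof -
  have "((\<lambda>q. smallest_singular_value (M q) - smallest_singular_value (augment (M q) (c q)))
      \<longlongrightarrow> smallest_singular_value A - smallest_singular_value (augment A b)) F"
    by (intro tendsto_intros assms)
  then have "\<forall>\<^sub>F q in F.
      0 < smallest_singular_value (M q) - smallest_singular_value (augment (M q) (c q))"
    using assms(1) by (intro order_tendstoD(1)) (auto simp: tls_generic_def)
  then show ?thesis
    by (rule eventually_mono) (simp add: tls_generic_def)
qed

text \<open>
  The old solution \<open>x\<close> nearly solves the new linear system \<open>P' x' = A'\<^sup>T b'\<close>: its residual tends to 0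
  because \<open>P'\<close> is continuous in the data. Coercivity of \<open>P'\<close> turns the residual into a bound on \<open>x' - x\<close>.
\<close>

lemma tendsto_tls_solution:
  fixes A :: "real^'n^'m"
  assumes "tls_generic A b" "tls_solution A b x"
    and M: "(M \<longlongrightarrow> A) F" and c: "(c \<longlongrightarrow> b) F"
    and y: "\<forall>\<^sub>F q in F. tls_solution (M q) (c q) (y q)"
  shows "(y \<longlongrightarrow> x) F"
proof -
  let ?R = "\<lambda>q. transpose (M q) *v c q - tls_matrix (M q) (c q) *v x"
  note [tendsto_intros] =
    bounded_bilinear.tendsto [OF bounded_bilinear_matrix_vector_mult]
    bounded_bilinear.tendsto [OF bounded_bilinear_transpose_vector_mult]
  have "(?R \<longlongrightarrow> transpose A *v b - tls_matrix A b *v x) F"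
    unfolding tls_matrix_mult by (intro tendsto_intros M c)
  then have "(?R \<longlongrightarrow> 0) F"
    using tls_solution_linear_system [OF assms(1,2)] by simp
  moreover have gap: "((\<lambda>q. tls_gap (M q) (c q)) \<longlongrightarrow> tls_gap A b) F"
    unfolding tls_gap_def by (intro tendsto_intros M c)
  ultimately have "((\<lambda>q. norm (?R q) / tls_gap (M q) (c q)) \<longlongrightarrow> 0 / tls_gap A b) F"
    using tls_gap_pos [OF assms(1)] by (intro tendsto_divide tendsto_norm_zero) auto
  then have lim: "((\<lambda>q. norm (?R q) / tls_gap (M q) (c q)) \<longlongrightarrow> 0) F"
    by simp
  have "\<forall>\<^sub>F q in F. norm (y q - x) \<le> norm (?R q) / tls_gap (M q) (c q)"
    using y eventually_tls_generic [OF assms(1) M c]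
  proof eventually_elim
    case (elim q)
    have "?R q = tls_matrix (M q) (c q) *v (y q - x)"
      using tls_solution_linear_system [OF elim(2,1)]
      by (simp add: matrix_vector_mult_diff_distrib)
    then show ?case
      using tls_matrix_coercive [of "M q" "c q" "y q - x"] tls_gap_pos [OF elim(2)]
      by (simp add: pos_le_divide_eq mult.commute)
  qed
  then have "((\<lambda>q. y q - x) \<longlongrightarrow> 0) F"
    using lim by (rule Lim_null_comparison)
  then show ?thesis by (rule LIM_zero_cancel)
qed

lemma has_derivative_tls_solution:
  fixes A :: "real^'n^'m" and b :: "real^'m"
  assumes gen: "tls_generic A b" and sol: "tls_solution A b x" and r: "r = b - A *v x"
  shows "((\<lambda>(A, b). THE x. tls_solution A b x) has_derivative
    (\<lambda>(dA, db). matrix_inv (tls_matrix A b) *v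
      (transpose dA *v r + transpose A *v (db - dA *v x)
        + (2 * (r \<bullet> (db - dA *v x)) / (1 + x \<bullet> x)) *\<^sub>R x))) (at (A, b))"
proof -
  define p where "p = (A, b)"
  define y where "y q = (THE x. tls_solution (fst q) (snd q) x)" for q :: "(real^'n^'m) \<times> (real^'m)"
  define \<rho> where "\<rho> q = snd q - fst q *v y q" for q
  have fst_p: "fst p = A" and snd_p: "snd p = b"
    by (simp_all add: p_def)
  have fst: "((\<lambda>q :: (real^'n^'m) \<times> (real^'m). fst q) \<longlongrightarrow> A) (at p)"
    and snd: "((\<lambda>q :: (real^'n^'m) \<times> (real^'m). snd q) \<longlongrightarrow> b) (at p)"
    by (auto simp: p_def intro!: tendsto_eq_intros)
  have generic: "\<forall>\<^sub>F q in at p. tls_generic (fst q) (snd q)"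
    by (rule eventually_tls_generic [OF gen fst snd])
  then have solution: "\<forall>\<^sub>F q in at p. tls_solution (fst q) (snd q) (y q)"
    by (rule eventually_mono) (simp add: y_def tls_solution_The)
  have y_lim: "(y \<longlongrightarrow> x) (at p)"
    by (rule tendsto_tls_solution [OF gen sol fst snd solution])
  have y_p: "y p = x"
    using tls_solution_unique [OF gen tls_solution_The [OF gen] sol] by (simp add: y_def p_def)
  have \<rho>_lim: "(\<rho> \<longlongrightarrow> r) (at p)"
    unfolding \<rho>_def r
    by (intro tendsto_intros fst snd y_lim
        bounded_bilinear.tendsto [OF bounded_bilinear_matrix_vector_mult])
  have pos: "1 + x \<bullet> x \<noteq> 0"
    by (metis add_pos_nonneg inner_ge_zero less_irrefl zero_less_one)
  have dA: "((\<lambda>q. fst q - A) has_derivative fst) (at p)"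
    and db: "((\<lambda>q. snd q - b) has_derivative snd) (at p)"
    by (auto intro!: derivative_eq_intros)

  \<comment> \<open>\<open>?e q z\<close> is \<open>db - dA z\<close> for the difference of \<open>q\<close> and \<open>(A, b)\<close>, and \<open>?t q\<close> is \<open>1 + x \<bullet> y q\<close>
    times the change of the squared singular value.\<close>
  let ?e = "\<lambda>q z. (snd q - b) - (fst q - A) *v z"
  let ?d = "\<lambda>h. snd h - fst h *v x"
  let ?t = "\<lambda>q. ?e q x \<bullet> \<rho> q + ?e q (y q) \<bullet> r"
  have e: "((\<lambda>q. ?e q (z q)) has_derivative ?d) (at p)" if "(z \<longlongrightarrow> x) (at p)" for z
    using that
    by (intro has_derivative_diff db
        has_derivative_bilinear_vanishing [OF bounded_bilinear_matrix_vector_mult dA])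
      (simp_all add: p_def)
  have D1: "((\<lambda>q. transpose (fst q - A) *v \<rho> q) has_derivative (\<lambda>h. transpose (fst h) *v r)) (at p)"
    by (intro has_derivative_bilinear_vanishing [OF bounded_bilinear_transpose_vector_mult dA] \<rho>_lim)
      (simp add: p_def)
  have D2: "((\<lambda>q. transpose A *v ?e q (y q)) has_derivative (\<lambda>h. transpose A *v ?d h)) (at p)"
    by (intro bounded_linear.has_derivative [OF matrix_vector_mul_bounded_linear] e y_lim)
  have D3: "((\<lambda>q. ?t q *\<^sub>R ((1 / (1 + x \<bullet> y q)) *\<^sub>R y q)) has_derivative
      (\<lambda>h. (?d h \<bullet> r + ?d h \<bullet> r) *\<^sub>R ((1 / (1 + x \<bullet> x)) *\<^sub>R x))) (at p)"
  proof (rule has_derivative_bilinear_vanishing [OF bounded_bilinear_scaleR])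
    show "(?t has_derivative (\<lambda>h. ?d h \<bullet> r + ?d h \<bullet> r)) (at p)"
      by (intro has_derivative_add e y_lim tendsto_const \<rho>_lim
          bounded_linear.has_derivative [OF bounded_linear_inner_left]
          has_derivative_bilinear_vanishing [OF bounded_bilinear_inner]) (simp add: p_def)
    show "((\<lambda>q. (1 / (1 + x \<bullet> y q)) *\<^sub>R y q) \<longlongrightarrow> (1 / (1 + x \<bullet> x)) *\<^sub>R x) (at p)"
      by (intro tendsto_intros y_lim pos)
  qed (simp add: p_def)
  have "((\<lambda>q. transpose (fst q - A) *v \<rho> q + transpose A *v ?e q (y q)
          + ?t q *\<^sub>R ((1 / (1 + x \<bullet> y q)) *\<^sub>R y q)) has_derivative
      (\<lambda>h. transpose (fst h) *v r + transpose A *v ?d h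
          + (?d h \<bullet> r + ?d h \<bullet> r) *\<^sub>R ((1 / (1 + x \<bullet> x)) *\<^sub>R x))) (at p)"
    (is "(?g has_derivative ?g') _")
    by (rule has_derivative_add [OF has_derivative_add [OF D1 D2] D3])
  from bounded_linear.has_derivative [OF matrix_vector_mul_bounded_linear this]
  have "((\<lambda>q. x + matrix_inv (tls_matrix A b) *v ?g q) has_derivative
      (\<lambda>h. 0 + matrix_inv (tls_matrix A b) *v ?g' h)) (at p)"
    by (rule has_derivative_add [OF has_derivative_const])
  moreover have "\<forall>\<^sub>F q in at p. x + matrix_inv (tls_matrix A b) *v ?g q = y q"
  proof -
    \<comment> \<open>Near \<open>(A, b)\<close> the factor in front of the eigenvalue difference does not vanish.\<close>
    have "((\<lambda>q. 1 + x \<bullet> y q) \<longlongrightarrow> 1 + x \<bullet> x) (at p)"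
      by (intro tendsto_intros y_lim)
    then have "\<forall>\<^sub>F q in at p. 1 + x \<bullet> y q \<noteq> 0"
      using pos by (rule tendsto_imp_eventually_ne)
    with generic solution show ?thesis
    proof eventually_elim
      case (elim q)
      let ?\<delta> = "(smallest_singular_value (augment (fst q) (snd q)))\<^sup>2
        - (smallest_singular_value (augment A b))\<^sup>2"
      have "?\<delta> = ?t q / (1 + x \<bullet> y q)"
        using tls_eigenvalue_difference [OF gen sol elim(1,2)] elim(3)
        unfolding \<rho>_def r by (simp add: nonzero_eq_divide_eq)
      then have "?g q = tls_matrix A b *v (y q - x)"
        unfolding tls_solution_difference [OF gen sol elim(1,2)] \<rho>_def by simp
      then show ?case
        by (simp add: tls_matrix_inverse [OF gen])
    qed
  qed
  ultimately have "(y has_derivative (\<lambda>h. 0 + matrix_inv (tls_matrix A b) *v ?g' h)) (at p)"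
    by (rule has_derivative_transform_eventually) (simp_all add: y_p fst_p snd_p)
  moreover have "y = (\<lambda>(A, b). THE x. tls_solution A b x)"
    by (auto simp: y_def)
  ultimately show ?thesis
    by (simp add: p_def case_prod_unfold inner_commute [of r] del: transpose_matrix_vector)
qed

section \<open>Condition numbers for the componentwise norm\<close>

text \<open>
  The admissible factors \<open>\<omega>\<close> form a closed set that is bounded below, so the least of them exists and
  is itself admissible; without this the value 1 would say nothing about \<open>\<omega> = 1\<close>.
\<close>

lemma componentwise_norm_eq_1D:
  fixes A dA :: "real^'n^'m" and b db :: "real^'m"
  assumes "componentwise_norm (A, b) (dA, db) = 1"
  shows "\<bar>dA\<bar> \<le> \<bar>A\<bar>" and "\<bar>db\<bar> \<le> \<bar>b\<bar>"
proof -
  define W where "W = {\<omega>. 0 \<le> \<omega> \<and> \<bar>dA\<bar> \<le> \<omega> *\<^sub>R \<bar>A\<bar> \<and> \<bar>db\<bar> \<le> \<omega> *\<^sub>R \<bar>b\<bar>}"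
  have W: "W \<noteq> {}" and least: "(LEAST \<omega>. \<omega> \<in> W) = 1"
    using assms by (auto simp: componentwise_norm_def W_def split: if_splits)
  have "W = {0..} \<inter> (\<Inter>i j. {\<omega>. \<bar>dA $ i $ j\<bar> \<le> \<omega> * \<bar>A $ i $ j\<bar>}) \<inter> (\<Inter>i. {\<omega>. \<bar>db $ i\<bar> \<le> \<omega> * \<bar>b $ i\<bar>})"
    by (auto simp: W_def less_eq_vec_def abs_vec_def)
  also have "closed \<dots>"
    by (intro closed_Int closed_INT ballI closed_atLeast closed_Collect_le continuous_intros)
  finally have "closed W" .
  moreover have bdd: "bdd_below W"
    by (rule bdd_belowI [of _ 0]) (simp add: W_def)
  ultimately have "Inf W \<in> W"
    using W by (intro closed_contains_Inf)
  then have "(LEAST \<omega>. \<omega> \<in> W) = Inf W"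
    by (rule Least_equality) (rule cInf_lower [OF _ bdd])
  with least \<open>Inf W \<in> W\<close> have "1 \<in> W" by simp
  then show "\<bar>dA\<bar> \<le> \<bar>A\<bar>" and "\<bar>db\<bar> \<le> \<bar>b\<bar>"
    by (simp_all add: W_def)
qed

lemma componentwise_norm_eq_1I:
  fixes A dA :: "real^'n^'m" and b db :: "real^'m"
  assumes "\<bar>dA\<bar> = \<bar>A\<bar>" "\<bar>db\<bar> = \<bar>b\<bar>" "(A, b) \<noteq> 0"
  shows "componentwise_norm (A, b) (dA, db) = 1"
proof -
  have iff: "\<bar>A\<bar> \<le> \<omega> *\<^sub>R \<bar>A\<bar> \<and> \<bar>b\<bar> \<le> \<omega> *\<^sub>R \<bar>b\<bar> \<longleftrightarrow> 1 \<le> \<omega>" for \<omega>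
  proof
    assume le: "\<bar>A\<bar> \<le> \<omega> *\<^sub>R \<bar>A\<bar> \<and> \<bar>b\<bar> \<le> \<omega> *\<^sub>R \<bar>b\<bar>"
    consider i j where "A $ i $ j \<noteq> 0" | i where "b $ i \<noteq> 0"
      using assms(3) by (auto simp: zero_prod_def vec_eq_iff)
    then show "1 \<le> \<omega>"
    proof cases
      case 1
      have "\<bar>A $ i $ j\<bar> \<le> \<omega> * \<bar>A $ i $ j\<bar>"
        using le by (simp add: less_eq_vec_def abs_vec_def)
      with 1 show ?thesis by simp
    next
      case 2
      have "\<bar>b $ i\<bar> \<le> \<omega> * \<bar>b $ i\<bar>"
        using le by (simp add: less_eq_vec_def abs_vec_def)
      with 2 show ?thesis by simp
    qed
  next
    assume "1 \<le> \<omega>"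
    then have "t \<le> \<omega> * t" if "0 \<le> t" for t
      using that mult_right_mono [of 1 \<omega> t] by simp
    then show "\<bar>A\<bar> \<le> \<omega> *\<^sub>R \<bar>A\<bar> \<and> \<bar>b\<bar> \<le> \<omega> *\<^sub>R \<bar>b\<bar>"
      by (simp add: less_eq_vec_def abs_vec_def)
  qed
  have least: "(LEAST \<omega> :: real. 0 \<le> \<omega> \<and> 1 \<le> \<omega>) = 1"
    by (rule Least_equality) auto
  have "\<exists>\<omega>\<ge>0. 1 \<le> (\<omega> :: real)"
    by (rule exI [of _ 1]) simp
  then show ?thesis
    by (simp add: componentwise_norm_def assms(1,2) iff least)
qed

lemma infnorm_le_iff: "infnorm (u :: real^'k) \<le> c \<longleftrightarrow> (\<forall>i. \<bar>u $ i\<bar> \<le> c)"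
proof
  assume "infnorm u \<le> c"
  then show "\<forall>i. \<bar>u $ i\<bar> \<le> c"
    using component_le_infnorm_cart order_trans by blast
next
  assume "\<forall>i. \<bar>u $ i\<bar> \<le> c"
  then show "infnorm u \<le> c"
    unfolding infnorm_cart by (intro cSup_least) auto
qed

lemma infnorm_attained:
  obtains i where "infnorm (u :: real^'k) = \<bar>u $ i\<bar>"
proof -
  let ?M = "Max (range (\<lambda>i. \<bar>u $ i\<bar>))"
  have "infnorm u \<le> ?M"
    unfolding infnorm_le_iff by auto
  moreover have "?M \<in> range (\<lambda>i. \<bar>u $ i\<bar>)"
    by (rule Max_in) auto
  ultimately show ?thesis
    using that component_le_infnorm_cart [of u] by (metis antisym imageE)
qed

lemma abs_matrix_vector_mult_le:
  fixes M :: "real^'n^'m"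
  assumes "\<bar>u\<bar> \<le> v"
  shows "\<bar>(M *v u) $ i\<bar> \<le> (\<bar>M\<bar> *v v) $ i"
proof -
  have "\<bar>u $ j\<bar> \<le> v $ j" for j
    using assms by (simp add: less_eq_vec_def abs_vec_def)
  then have "\<bar>\<Sum>j\<in>UNIV. M $ i $ j * u $ j\<bar> \<le> (\<Sum>j\<in>UNIV. \<bar>M $ i $ j\<bar> * v $ j)"
    by (intro order_trans [OF sum_abs] sum_mono) (auto simp: abs_mult intro!: mult_left_mono)
  then show ?thesis
    by (simp add: matrix_vector_mult_def abs_vec_def)
qed

text \<open>
  Let \<open>i\<close> be a row in which \<open>\<bar>M\<bar> vec(\<bar>A\<bar>) + \<bar>N\<bar> \<bar>b\<bar>\<close> is largest. Giving each entry of the data the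
  sign of its coefficient in that row turns the row into the sum of the absolute values, while all other
  rows stay below their bounds, which are not larger.
\<close>

lemma cond_number_infnorm:
  fixes F :: "(real^'n^'m) \<times> (real^'m) \<Rightarrow> real^'k"
  assumes "(F has_derivative (\<lambda>(dA, db). M *v vec_cols dA + N *v db)) (at (A, b))"
    and "(A, b) \<noteq> 0"
  shows "cond_number infnorm F (A, b) = infnorm (\<bar>M\<bar> *v vec_cols \<bar>A\<bar> + \<bar>N\<bar> *v \<bar>b\<bar>)"
proof -
  let ?y = "\<bar>M\<bar> *v vec_cols \<bar>A\<bar> + \<bar>N\<bar> *v \<bar>b\<bar>"
  have deriv: "frechet_derivative F (at (A, b)) = (\<lambda>(dA, db). M *v vec_cols dA + N *v db)"
    using frechet_derivative_at [OF assms(1)] by simp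
  have upper: "infnorm (M *v vec_cols dA + N *v db) \<le> infnorm ?y"
    if d: "componentwise_norm (A, b) (dA, db) = 1" for dA db
    unfolding infnorm_le_iff
  proof
    fix i
    have "\<bar>vec_cols dA\<bar> \<le> vec_cols \<bar>A\<bar>"
      using componentwise_norm_eq_1D(1) [OF d] by (simp add: vec_cols_def less_eq_vec_def abs_vec_def)
    then have "\<bar>(M *v vec_cols dA + N *v db) $ i\<bar> \<le> ?y $ i"
      using abs_matrix_vector_mult_le [of _ _ M i]
        abs_matrix_vector_mult_le [OF componentwise_norm_eq_1D(2) [OF d], of N i]
      by (simp add: order_trans [OF abs_triangle_ineq add_mono])
    also have "?y $ i \<le> infnorm ?y"
      using component_le_infnorm_cart [of ?y i] by linarith
    finally show "\<bar>(M *v vec_cols dA + N *v db) $ i\<bar> \<le> infnorm ?y" .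
  qed
  obtain i where i: "infnorm ?y = \<bar>?y $ i\<bar>"
    by (rule infnorm_attained)
  \<comment> \<open>The sign of 0 must not be 0: the entries of the perturbation have to keep the modulus of the data,
    otherwise its norm could be less than 1.\<close>
  define \<epsilon> :: "real \<Rightarrow> real" where "\<epsilon> t = (if 0 \<le> t then 1 else - 1)" for t
  have \<epsilon>: "\<bar>\<epsilon> t * z\<bar> = \<bar>z\<bar>" "t * (\<epsilon> t * z) = \<bar>t\<bar> * z" for t z
    by (simp_all add: \<epsilon>_def)
  define dA where "dA = (\<chi> k j. \<epsilon> (M $ i $ (j, k)) * \<bar>A $ k $ j\<bar>)"
  define db where "db = (\<chi> k. \<epsilon> (N $ i $ k) * \<bar>b $ k\<bar>)"
  have d: "componentwise_norm (A, b) (dA, db) = 1"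
    by (rule componentwise_norm_eq_1I) (simp_all add: dA_def db_def abs_vec_def \<epsilon> assms(2))
  have "(M *v vec_cols dA + N *v db) $ i = ?y $ i"
    by (simp add: matrix_vector_mult_def vec_cols_def dA_def db_def abs_vec_def \<epsilon>)
  then have "infnorm ?y \<le> infnorm (M *v vec_cols dA + N *v db)"
    using component_le_infnorm_cart [of "M *v vec_cols dA + N *v db" i] by (simp only: i)
  with upper [OF d] have attained: "infnorm ?y = infnorm (M *v vec_cols dA + N *v db)"
    by (rule antisym [rotated])
  show ?thesis
    unfolding cond_number_def deriv
  proof (rule Greatest_equality)
    show "\<exists>d. componentwise_norm (A, b) d = 1 \<and>
        infnorm ?y = infnorm (case d of (dA, db) \<Rightarrow> M *v vec_cols dA + N *v db)"
      using d attained by (intro exI [of _ "(dA, db)"]) simp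
  qed (use upper in auto)
qed

section \<open>Kronecker products acting on vectorized matrices\<close>

lemma sum_UNIV_prod:
  "(\<Sum>p\<in>UNIV. f p) = (\<Sum>i\<in>UNIV. \<Sum>j\<in>UNIV. f (i, j))"
  for f :: "'a :: finite \<times> 'b :: finite \<Rightarrow> 'c :: comm_monoid_add"
  unfolding UNIV_Times_UNIV [symmetric] sum.cartesian_product by simp

text \<open>
  An instance of \<open>(x\<^sup>T \<otimes> B) vec M = vec (B M x)\<close>.
\<close>

lemma kron_row_matrix_mult_vec_cols:
  "rows_fst_unit (kron (row_matrix x) B) *v vec_cols M = B *v (M *v x)"
proof -
  have "(rows_fst_unit (kron (row_matrix x) B) *v vec_cols M) $ k = (B *v (M *v x)) $ k" for k
  proof -
    have "(B *v (M *v x)) $ k = (\<Sum>i\<in>UNIV. \<Sum>j\<in>UNIV. x $ j * B $ k $ i * M $ i $ j)"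
      by (simp add: matrix_vector_mult_def sum_distrib_left mult_ac)
    also have "\<dots> = (\<Sum>j\<in>UNIV. \<Sum>i\<in>UNIV. x $ j * B $ k $ i * M $ i $ j)"
      by (rule sum.swap)
    finally show ?thesis
      by (simp add: matrix_vector_mult_def sum_UNIV_prod rows_fst_unit_def kron_def row_matrix_def
          vec_cols_def)
  qed
  then show ?thesis by (simp add: vec_eq_iff)
qed

text \<open>
  An instance of \<open>(I \<otimes> r\<^sup>T) vec M = vec (r\<^sup>T M)\<close>.
\<close>

lemma kron_mat_1_mult_vec_cols:
  fixes M :: "real^'n^'m"
  shows "rows_snd_unit (kron (mat 1 :: real^'n^'n) (row_matrix r)) *v vec_cols M = transpose M *v r"
proof -
  have "(rows_snd_unit (kron (mat 1 :: real^'n^'n) (row_matrix r)) *v vec_cols M) $ k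
      = (transpose M *v r) $ k" for k
  proof -
    have "(rows_snd_unit (kron (mat 1 :: real^'n^'n) (row_matrix r)) *v vec_cols M) $ k
        = (\<Sum>j\<in>UNIV. if k = j then (\<Sum>i\<in>UNIV. r $ i * M $ i $ j) else 0)"
      unfolding matrix_vector_mult_def sum_UNIV_prod rows_snd_unit_def kron_def row_matrix_def
        vec_cols_def mat_def vec_lambda_beta fst_conv snd_conv by (intro sum.cong refl) auto
    also have "\<dots> = (transpose M *v r) $ k"
      by (simp add: matrix_vector_mult_def transpose_def mult.commute del: transpose_matrix_vector)
    finally show ?thesis .
  qed
  then show ?thesis by (simp add: vec_eq_iff del: transpose_matrix_vector)
qed

section \<open>The condition numbers of the solution\<close>

theorem corollary3p1:
  fixes A :: "real^'n^'m" and b :: "real^'m" and L :: "real^'n^'k"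
    and x :: "real^'n" and r :: "real^'m" and P :: "real^'n^'n"
    and \<N> :: "real^('n \<times> 'm)^'n" and \<H> :: "real^'m^'n"
  assumes "CARD('m) > CARD('n)"
    and "CARD('k) \<le> CARD('n)"
    and "tls_generic A b"
    and "tls_solution A b x"
    and "r = b - A *v x"
    and "P = transpose A ** A - (smallest_singular_value (augment A b))\<^sup>2 *\<^sub>R mat 1"
    and "\<N> = matrix_inv P **
           (- rows_fst_unit (kron (row_matrix x) (transpose A + (2 / (1 + x \<bullet> x)) *\<^sub>R outer x r))
            + rows_snd_unit (kron (mat 1 :: real^'n^'n) (row_matrix r)))"
    and "\<H> = matrix_inv P ** (transpose A + (2 / (1 + x \<bullet> x)) *\<^sub>R outer x r)"
  shows "cond_number infnorm (tls_map L) (A, b)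
           = infnorm (\<bar>L ** \<N>\<bar> *v vec_cols \<bar>A\<bar> + \<bar>L ** \<H>\<bar> *v \<bar>b\<bar>)
    \<and> (L *v x \<noteq> 0 \<longrightarrow>
         rel_cond_number infnorm (tls_map L) (A, b)
           = infnorm (\<bar>L ** \<N>\<bar> *v vec_cols \<bar>A\<bar> + \<bar>L ** \<H>\<bar> *v \<bar>b\<bar>) / infnorm (L *v x))"
proof -
  let ?B = "transpose A + (2 / (1 + x \<bullet> x)) *\<^sub>R outer x r"
  have P: "P = tls_matrix A b"
    by (simp add: assms(6) tls_matrix_def)
  have B: "?B *v u = transpose A *v u + (2 * (r \<bullet> u) / (1 + x \<bullet> x)) *\<^sub>R x" for u
    by (simp add: matrix_vector_mult_add_rdistrib scaleR_matrix_vector_assoc [symmetric] outer_mult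
        del: transpose_matrix_vector)
  have matrix_minus_mult: "(- M) *v u = - (M *v u)" for M :: "real^('n \<times> 'm)^'n" and u
    by (simp add: matrix_vector_mult_def vec_eq_iff sum_negf)
  have blocks: "\<N> *v vec_cols dA + \<H> *v db
      = matrix_inv P *v (transpose dA *v r + transpose A *v (db - dA *v x)
          + (2 * (r \<bullet> (db - dA *v x)) / (1 + x \<bullet> x)) *\<^sub>R x)" for dA db
  proof -
    have "\<N> *v vec_cols dA + \<H> *v db
        = matrix_inv P *v (- (?B *v (dA *v x)) + transpose dA *v r + ?B *v db)"
      unfolding assms(7,8) matrix_vector_mul_assoc [symmetric]
      by (simp only: matrix_vector_mult_add_rdistrib [of "- _"] matrix_minus_mult
          kron_row_matrix_mult_vec_cols kron_mat_1_mult_vec_cols matrix_vector_right_distrib)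
    also have "- (?B *v (dA *v x)) + transpose dA *v r + ?B *v db
        = transpose dA *v r + ?B *v (db - dA *v x)"
      by (simp only: matrix_vector_mult_diff_distrib [of ?B]) (simp del: transpose_matrix_vector)
    finally show ?thesis
      unfolding B by (simp only: add.assoc)
  qed
  have "((\<lambda>q. L *v (case q of (A, b) \<Rightarrow> THE x. tls_solution A b x)) has_derivative
      (\<lambda>h. L *v (case h of (dA, db) \<Rightarrow> \<N> *v vec_cols dA + \<H> *v db))) (at (A, b))"
    unfolding blocks P
    by (rule bounded_linear.has_derivative [OF matrix_vector_mul_bounded_linear
          has_derivative_tls_solution [OF assms(3-5)]])
  then have "(tls_map L has_derivative
      (\<lambda>(dA, db). (L ** \<N>) *v vec_cols dA + (L ** \<H>) *v db)) (at (A, b))"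
    by (simp add: tls_map_def case_prod_unfold matrix_vector_right_distrib matrix_vector_mul_assoc)
  moreover have nonzero: "(A, b) \<noteq> 0"
    using tls_generic_nonzero [OF assms(3)] by (simp add: zero_prod_def)
  ultimately have cond: "cond_number infnorm (tls_map L) (A, b)
      = infnorm (\<bar>L ** \<N>\<bar> *v vec_cols \<bar>A\<bar> + \<bar>L ** \<H>\<bar> *v \<bar>b\<bar>)"
    by (rule cond_number_infnorm)
  have "(THE x. tls_solution A b x) = x"
    using tls_solution_unique [OF assms(3) tls_solution_The [OF assms(3)] assms(4)] .
  then have "tls_map L (A, b) = L *v x"
    by (simp add: tls_map_def)
  moreover have "componentwise_norm (A, b) (A, b) = 1"
    by (rule componentwise_norm_eq_1I [OF refl refl nonzero])
  ultimately show ?thesis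
    by (simp add: rel_cond_number_def cond)
qed

end
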